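(* Let $(X,\xi)$ and $(Y,\zeta)$ be $F$-coalgebras. For all states $x\in X$, $y\in Y$ we have $$d_\Lambda(x,y)=d_{\mathbf{L}_\Lambda}(x,y).$$
   Context: Let $\mathcal V=[0,1]$ with the usual order, with $\vee,\wedge$ denoting suprema and infima; predicates $A\in 2^X$ are identified with subsets of $X$. Let $F\colon\mathbf{Set}\to\mathbf{Set}$ be a functor. An $F$-coalgebra $(X,\xi)$ consists of a set $X$ and a map $\xi\colon X\to FX$. A $2$-to-$\mathcal V$ predicate lifting $\lambda$ for $F$ is a family of maps $\lambda_X\colon 2^X\to\mathcal V^{FX}$, one for each set $X$, such that $\lambda_Y(A)(Ff(a))=\lambda_X(f^{-1}[A])(a)$ for all $f\colon X\to Y$, $A\subseteq Y$, $a\in FX$. It is monotone if $A\subseteq B$ implies $\lambda_X(A)(a)\le\lambda_X(B)(a)$ for all $a$. Fix a set $\Lambda$ of monotone $2$-to-$\mathcal V$ predicate liftings for $F$. For a relation $R\subseteq X\times Y$ and $A\subseteq X$, put $R[A]=\{y\mid \exists x\in A.\ x\,R\,y\}$. For $\epsilon\in\mathcal V$ and $R\subseteq X\times Y$, define the relation $L_{\epsilon,\Lambda}R\subseteq FX\times FY$ by: $a\,(L_{\epsilon,\Lambda}R)\,b$ iff $\lambda_Y(R[A])(b)\ge\lambda_X(A)(a)-\epsilon$ for all $\lambda\in\Lambda$ and all $A\subseteq X$. Given coalgebras $(X,\xi)$, $(Y,\zeta)$, a relation $R\subseteq X\times Y$ is an $\epsilon$-$\Lambda$-simulation if $\xi(x)\,(L_{\epsilon,\Lambda}R)\,\zeta(y)$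 whenever $x\,R\,y$. Write $x\preceq_{\epsilon,\Lambda}y$ if some $\epsilon$-$\Lambda$-simulation relates $x$ and $y$. The threshold-based $\Lambda$-behavioural distance is $$d_\Lambda(x,y)=\bigwedge\{\epsilon\in\mathcal V\mid x\preceq_{\epsilon,\Lambda}y\}.$$ For a $[0,1]$-valued relation $r\colon X\times Y\to\mathcal V$, put $r_\epsilon=\{(x,y)\mid r(x,y)\le\epsilon\}$, and define $$\mathbf L_\Lambda r(a,b)=\bigwedge\{\epsilon\in\mathcal V\mid a\,(L_{\epsilon,\Lambda}r_\epsilon)\,b\}$$ for $a\in FX$, $b\in FY$. An $\mathbf L_\Lambda$-simulation between $(X,\xi)$ and $(Y,\zeta)$ is an $r\colon X\times Y\to\mathcal V$ with $\mathbf L_\Lambda r(\xi(x),\zeta(y))\le r(x,y)$ for all $x,y$. The $\mathbf L_\Lambda$-behavioural distance $d_{\mathbf L_\Lambda}$ is the pointwise least such $r$; it exists by Knaster–Tarski, since $\mathbf L_\Lambda$ is monotone in $r$. *)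

theory Defs
  imports Complex_Main "HOL-Library.FuncSet"
begin

text \<open>
  HOL cannot quantify over type constructors, so \<open>Set\<close> is rendered as the category whose
  objects are the subsets of an arbitrary type \<open>'u\<close> and whose morphisms from \<open>X\<close> to \<open>Y\<close> are
  the extensional functions in \<open>X \<rightarrow>\<^sub>E Y\<close>. A functor consists of an object part \<open>F\<close>, with values
  in the subsets of an arbitrary type \<open>'f\<close>, and a morphism part \<open>Fmap X Y\<close>.
\<close>

locale set_functor =
  fixes F :: "'u set \<Rightarrow> 'f set"
    and Fmap :: "'u set \<Rightarrow> 'u set \<Rightarrow> ('u \<Rightarrow> 'u) \<Rightarrow> 'f \<Rightarrow> 'f"
  assumes Fmap_hom: "f \<in> X \<rightarrow>\<^sub>E Y \<Longrightarrow> Fmap X Y f \<in> F X \<rightarrow>\<^sub>E F Y"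
    and Fmap_id: "Fmap X X (\<lambda>x\<in>X. x) = (\<lambda>a\<in>F X. a)"
    and Fmap_compose: "f \<in> X \<rightarrow>\<^sub>E Y \<Longrightarrow> g \<in> Y \<rightarrow>\<^sub>E Z \<Longrightarrow>
      Fmap X Z (compose X g f) = compose (F X) (Fmap Y Z g) (Fmap X Y f)"

definition coalgebra :: "('u set \<Rightarrow> 'f set) \<Rightarrow> 'u set \<Rightarrow> ('u \<Rightarrow> 'f) \<Rightarrow> bool" where
  "coalgebra F X \<xi> \<longleftrightarrow> \<xi> \<in> X \<rightarrow> F X"

text \<open>
  A family of maps from predicates on \<open>X\<close> to \<open>[0,1]\<close>-valued predicates on \<open>F X\<close> is a function
  \<open>l\<close> of which only the values \<open>l X A a\<close> with \<open>A \<subseteq> X\<close> and \<open>a \<in> F X\<close> are relevant.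
\<close>

type_synonym ('u, 'f) lifting = "'u set \<Rightarrow> 'u set \<Rightarrow> 'f \<Rightarrow> real"

definition predicate_lifting ::
  "('u set \<Rightarrow> 'f set) \<Rightarrow> ('u set \<Rightarrow> 'u set \<Rightarrow> ('u \<Rightarrow> 'u) \<Rightarrow> 'f \<Rightarrow> 'f) \<Rightarrow> ('u, 'f) lifting \<Rightarrow> bool" where
  "predicate_lifting F Fmap l \<longleftrightarrow>
     (\<forall>X A a. A \<subseteq> X \<longrightarrow> a \<in> F X \<longrightarrow> l X A a \<in> {0..1}) \<and>
     (\<forall>X Y f A a. f \<in> X \<rightarrow>\<^sub>E Y \<longrightarrow> A \<subseteq> Y \<longrightarrow> a \<in> F X \<longrightarrow>
        l Y A (Fmap X Y f a) = l X (f -` A \<inter> X) a)"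

definition monotone_lifting :: "('u set \<Rightarrow> 'f set) \<Rightarrow> ('u, 'f) lifting \<Rightarrow> bool" where
  "monotone_lifting F l \<longleftrightarrow>
     (\<forall>X A B a. A \<subseteq> B \<longrightarrow> B \<subseteq> X \<longrightarrow> a \<in> F X \<longrightarrow> l X A a \<le> l X B a)"

text \<open>
  The meet of \<open>S \<subseteq> [0,1]\<close> in the complete lattice \<open>[0,1]\<close>. Inserting the top element makes the
  empty meet 1, whereas \<open>Inf {}\<close> is unspecified on the reals.
\<close>

definition unit_Inf :: "real set \<Rightarrow> real" where
  "unit_Inf S = Inf (insert 1 S)"

lemma le_unit_Inf_iff:
  assumes "S \<subseteq> {0..1}" "c \<in> {0..1}"
  shows "c \<le> unit_Inf S \<longleftrightarrow> (\<forall>s\<in>S. c \<le> s)"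
proof -
  have "bdd_below (insert 1 S)"
    using assms(1) by (intro bdd_belowI[where m = 0]) auto
  then show ?thesis
    using assms(2) by (simp add: unit_Inf_def le_cInf_iff)
qed

lemma unit_Inf_in_unit: "S \<subseteq> {0..1} \<Longrightarrow> unit_Inf S \<in> {0..1}"
  using le_unit_Inf_iff[of S 0] unfolding unit_Inf_def
  by (auto intro!: cInf_lower bdd_belowI[where m = 0])

definition lift_rel ::
  "('u set \<Rightarrow> 'f set) \<Rightarrow> ('u, 'f) lifting set \<Rightarrow> 'u set \<Rightarrow> 'u set \<Rightarrow> real \<Rightarrow> 'u rel \<Rightarrow> 'f rel" where
  "lift_rel F \<Lambda> X Y \<epsilon> R =
     {(a, b) \<in> F X \<times> F Y. \<forall>l\<in>\<Lambda>. \<forall>A\<subseteq>X. l Y (R `` A) b \<ge> l X A a - \<epsilon>}"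

definition eps_simulation ::
  "('u set \<Rightarrow> 'f set) \<Rightarrow> ('u, 'f) lifting set \<Rightarrow> 'u set \<Rightarrow> ('u \<Rightarrow> 'f) \<Rightarrow> 'u set \<Rightarrow> ('u \<Rightarrow> 'f) \<Rightarrow>
   real \<Rightarrow> 'u rel \<Rightarrow> bool" where
  "eps_simulation F \<Lambda> X \<xi> Y \<zeta> \<epsilon> R \<longleftrightarrow>
     R \<subseteq> X \<times> Y \<and> (\<forall>(x, y)\<in>R. (\<xi> x, \<zeta> y) \<in> lift_rel F \<Lambda> X Y \<epsilon> R)"

definition eps_similar ::
  "('u set \<Rightarrow> 'f set) \<Rightarrow> ('u, 'f) lifting set \<Rightarrow> 'u set \<Rightarrow> ('u \<Rightarrow> 'f) \<Rightarrow> 'u set \<Rightarrow> ('u \<Rightarrow> 'f) \<Rightarrow>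
   real \<Rightarrow> 'u \<Rightarrow> 'u \<Rightarrow> bool" where
  "eps_similar F \<Lambda> X \<xi> Y \<zeta> \<epsilon> x y \<longleftrightarrow> (\<exists>R. eps_simulation F \<Lambda> X \<xi> Y \<zeta> \<epsilon> R \<and> (x, y) \<in> R)"

definition threshold_dist ::
  "('u set \<Rightarrow> 'f set) \<Rightarrow> ('u, 'f) lifting set \<Rightarrow> 'u set \<Rightarrow> ('u \<Rightarrow> 'f) \<Rightarrow> 'u set \<Rightarrow> ('u \<Rightarrow> 'f) \<Rightarrow>
   'u \<Rightarrow> 'u \<Rightarrow> real" where
  "threshold_dist F \<Lambda> X \<xi> Y \<zeta> x y = unit_Inf {\<epsilon> \<in> {0..1}. eps_similar F \<Lambda> X \<xi> Y \<zeta> \<epsilon> x y}"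

definition sublevel :: "'u set \<Rightarrow> 'u set \<Rightarrow> ('u \<times> 'u \<Rightarrow> real) \<Rightarrow> real \<Rightarrow> 'u rel" where
  "sublevel X Y r \<epsilon> = {(x, y) \<in> X \<times> Y. r (x, y) \<le> \<epsilon>}"

definition fuzzy_lift ::
  "('u set \<Rightarrow> 'f set) \<Rightarrow> ('u, 'f) lifting set \<Rightarrow> 'u set \<Rightarrow> 'u set \<Rightarrow> ('u \<times> 'u \<Rightarrow> real) \<Rightarrow>
   'f \<times> 'f \<Rightarrow> real" where
  "fuzzy_lift F \<Lambda> X Y r =
     (\<lambda>(a, b)\<in>F X \<times> F Y. unit_Inf {\<epsilon> \<in> {0..1}. (a, b) \<in> lift_rel F \<Lambda> X Y \<epsilon> (sublevel X Y r \<epsilon>)})"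

definition fuzzy_simulation ::
  "('u set \<Rightarrow> 'f set) \<Rightarrow> ('u, 'f) lifting set \<Rightarrow> 'u set \<Rightarrow> ('u \<Rightarrow> 'f) \<Rightarrow> 'u set \<Rightarrow> ('u \<Rightarrow> 'f) \<Rightarrow>
   ('u \<times> 'u \<Rightarrow> real) \<Rightarrow> bool" where
  "fuzzy_simulation F \<Lambda> X \<xi> Y \<zeta> r \<longleftrightarrow>
     r \<in> X \<times> Y \<rightarrow>\<^sub>E {0..1} \<and>
     (\<forall>x\<in>X. \<forall>y\<in>Y. fuzzy_lift F \<Lambda> X Y r (\<xi> x, \<zeta> y) \<le> r (x, y))"

text \<open>
  Since simulations are extensional on \<open>X \<times> Y\<close>, the order on the function type
  \<open>'u \<times> 'u \<Rightarrow> real\<close> compares them pointwise on \<open>X \<times> Y\<close>. For monotone liftings, a least one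
  exists by Knaster-Tarski.
\<close>

definition fuzzy_dist ::
  "('u set \<Rightarrow> 'f set) \<Rightarrow> ('u, 'f) lifting set \<Rightarrow> 'u set \<Rightarrow> ('u \<Rightarrow> 'f) \<Rightarrow> 'u set \<Rightarrow> ('u \<Rightarrow> 'f) \<Rightarrow>
   'u \<times> 'u \<Rightarrow> real" where
  "fuzzy_dist F \<Lambda> X \<xi> Y \<zeta> = (LEAST r. fuzzy_simulation F \<Lambda> X \<xi> Y \<zeta> r)"

end

theory Submission imports Defs begin

text \<open>
  The threshold-based distance is itself a fuzzy simulation: a witnessing
  \<open>\<delta>\<close>-simulation is contained in its \<open>\<delta>\<close>-sublevel relation. It is the least one because, for every
  fuzzy simulation \<open>r\<close>, the strict sublevel relation \<open>r < \<delta>\<close> is a \<open>\<delta>\<close>-simulation. Strictness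
  matters: the infimum defining the lifted distance need not be attained, but if it is below
  \<open>\<delta>\<close>, then some \<open>\<epsilon> < \<delta>\<close> in the set works.
\<close>

lemma unit_Inf_lower:
  assumes "S \<subseteq> {0..1}" "s \<in> S"
  shows "unit_Inf S \<le> s"
  using assms le_unit_Inf_iff[OF assms(1) unit_Inf_in_unit[OF assms(1)]] by auto

text \<open>Since \<open>c \<le> 1\<close>, the top element inserted by \<open>unit_Inf\<close>
  cannot lie below \<open>c\<close>, so the witness comes from \<open>S\<close> itself.\<close>

lemma unit_Inf_lessE:
  assumes "unit_Inf S < c" "c \<le> 1"
  obtains s where "s \<in> S" "s < c"
proof -
  obtain s where "s \<in> insert 1 S" "s < c"
    using cInf_lessD[of "insert 1 S" c] assms(1) by (auto simp: unit_Inf_def)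
  with assms(2) that show ?thesis by auto
qed

text \<open>A larger relation has larger images, on which monotone liftings take larger values,
  while a larger threshold weakens the required lower bound.\<close>

lemma lift_rel_mono:
  assumes mono: "\<forall>l\<in>\<Lambda>. monotone_lifting F l"
    and "\<epsilon> \<le> \<delta>" "R \<subseteq> S" "S \<subseteq> X \<times> Y"
  shows "lift_rel F \<Lambda> X Y \<epsilon> R \<subseteq> lift_rel F \<Lambda> X Y \<delta> S"
proof (rule subrelI)
  fix a b assume "(a, b) \<in> lift_rel F \<Lambda> X Y \<epsilon> R"
  then have ab: "a \<in> F X" "b \<in> F Y"
    and le: "\<And>l A. l \<in> \<Lambda> \<Longrightarrow> A \<subseteq> X \<Longrightarrow> l X A a - \<epsilon> \<le> l Y (R `` A) b"
    by (auto simp: lift_rel_def)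
  have "l X A a - \<delta> \<le> l Y (S `` A) b" if l: "l \<in> \<Lambda>" and A: "A \<subseteq> X" for l A
  proof -
    \<comment> \<open>\<open>monotone_lifting\<close> compares only predicates on the carrier, so
      the larger image has to lie inside \<open>Y\<close>.\<close>
    have "R `` A \<subseteq> S `` A" "S `` A \<subseteq> Y"
      using assms(3,4) by auto
    then have "l Y (R `` A) b \<le> l Y (S `` A) b"
      using mono l ab by (simp add: monotone_lifting_def)
    then show ?thesis
      using le[OF l A] \<open>\<epsilon> \<le> \<delta>\<close> by linarith
  qed
  with ab show "(a, b) \<in> lift_rel F \<Lambda> X Y \<delta> S"
    by (simp add: lift_rel_def)
qed

text \<open>The witnessing relation is kept; only its threshold is relaxed.\<close>

lemma eps_similar_mono:
  assumes "\<forall>l\<in>\<Lambda>. monotone_lifting F l" "\<epsilon> \<le> \<delta>" "eps_similar F \<Lambda> X \<xi> Y \<zeta> \<epsilon> x y"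
  shows "eps_similar F \<Lambda> X \<xi> Y \<zeta> \<delta> x y"
proof -
  obtain R where R: "R \<subseteq> X \<times> Y" "(x, y) \<in> R"
    "\<forall>(x, y)\<in>R. (\<xi> x, \<zeta> y) \<in> lift_rel F \<Lambda> X Y \<epsilon> R"
    using assms(3) unfolding eps_similar_def eps_simulation_def by blast
  have "\<forall>(x, y)\<in>R. (\<xi> x, \<zeta> y) \<in> lift_rel F \<Lambda> X Y \<delta> R"
    using R(3) subsetD[OF lift_rel_mono[OF assms(1,2) subset_refl R(1)]] by fast
  with R show ?thesis
    unfolding eps_similar_def eps_simulation_def by blast
qed

lemma threshold_dist_in_unit: "threshold_dist F \<Lambda> X \<xi> Y \<zeta> x y \<in> {0..1}"
  unfolding threshold_dist_def by (rule unit_Inf_in_unit) auto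

lemma threshold_dist_le:
  assumes "eps_similar F \<Lambda> X \<xi> Y \<zeta> \<epsilon> x y" "\<epsilon> \<in> {0..1}"
  shows "threshold_dist F \<Lambda> X \<xi> Y \<zeta> x y \<le> \<epsilon>"
  unfolding threshold_dist_def using assms by (intro unit_Inf_lower) auto

text \<open>The infimum may fail to be attained, but some threshold below \<delta> admits a
  simulation, and similarity is upward closed in the threshold.\<close>

lemma eps_similar_if_threshold_dist_less:
  assumes "\<forall>l\<in>\<Lambda>. monotone_lifting F l"
    and "threshold_dist F \<Lambda> X \<xi> Y \<zeta> x y < \<delta>" "\<delta> \<le> 1"
  shows "eps_similar F \<Lambda> X \<xi> Y \<zeta> \<delta> x y"
proof -
  obtain \<epsilon> where "eps_similar F \<Lambda> X \<xi> Y \<zeta> \<epsilon> x y" "\<epsilon> < \<delta>"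
    using unit_Inf_lessE[OF assms(2)[unfolded threshold_dist_def] assms(3)] by blast
  then show ?thesis
    using eps_similar_mono[OF assms(1) less_imp_le] by blast
qed

lemma fuzzy_lift_le:
  assumes "(a, b) \<in> lift_rel F \<Lambda> X Y \<epsilon> (sublevel X Y r \<epsilon>)" "\<epsilon> \<in> {0..1}"
  shows "fuzzy_lift F \<Lambda> X Y r (a, b) \<le> \<epsilon>"
proof -
  have "a \<in> F X" "b \<in> F Y"
    using assms(1) by (auto simp: lift_rel_def)
  then show ?thesis
    unfolding fuzzy_lift_def using assms by (auto intro!: unit_Inf_lower)
qed

lemma fuzzy_lift_in_unit:
  assumes "a \<in> F X" "b \<in> F Y"
  shows "fuzzy_lift F \<Lambda> X Y r (a, b) \<in> {0..1}"
proof -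
  have "unit_Inf {\<epsilon> \<in> {0..1}. (a, b) \<in> lift_rel F \<Lambda> X Y \<epsilon> (sublevel X Y r \<epsilon>)} \<in> {0..1}"
    by (rule unit_Inf_in_unit) auto
  then show ?thesis
    using assms by (simp add: fuzzy_lift_def)
qed

text \<open>The membership assumptions ensure that \<open>fuzzy_lift\<close> is the infimum here and
  not the default value outside its domain.\<close>

lemma fuzzy_lift_lessE:
  assumes "a \<in> F X" "b \<in> F Y" "fuzzy_lift F \<Lambda> X Y r (a, b) < \<delta>" "\<delta> \<le> 1"
  obtains \<epsilon> where "\<epsilon> < \<delta>" "(a, b) \<in> lift_rel F \<Lambda> X Y \<epsilon> (sublevel X Y r \<epsilon>)"
proof -
  have "unit_Inf {\<epsilon> \<in> {0..1}. (a, b) \<in> lift_rel F \<Lambda> X Y \<epsilon> (sublevel X Y r \<epsilon>)} < \<delta>"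
    using assms(1-3) by (simp add: fuzzy_lift_def)
  then show thesis
    using unit_Inf_lessE[OF _ assms(4)] that by blast
qed

lemma fuzzy_simulation_threshold_dist:
  assumes mono: "\<forall>l\<in>\<Lambda>. monotone_lifting F l"
    and coalg: "coalgebra F X \<xi>" "coalgebra F Y \<zeta>"
  shows "fuzzy_simulation F \<Lambda> X \<xi> Y \<zeta> (\<lambda>(x, y)\<in>X \<times> Y. threshold_dist F \<Lambda> X \<xi> Y \<zeta> x y)"
    (is "fuzzy_simulation _ _ _ _ _ _ ?r")
  unfolding fuzzy_simulation_def
proof (intro conjI ballI)
  show "?r \<in> X \<times> Y \<rightarrow>\<^sub>E {0..1}"
    by (auto simp: restrict_PiE_iff threshold_dist_in_unit simp del: atLeastAtMost_iff)
next
  fix x y assume xy: "x \<in> X" "y \<in> Y"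
  show "fuzzy_lift F \<Lambda> X Y ?r (\<xi> x, \<zeta> y) \<le> ?r (x, y)"
  \<comment> \<open>A simulation witnessing the distance is guaranteed only at thresholds strictly
    above it, so the bound is shown for each such \<delta>.\<close>
  proof (rule dense_ge)
    fix \<delta> assume "?r (x, y) < \<delta>"
    with xy have less: "threshold_dist F \<Lambda> X \<xi> Y \<zeta> x y < \<delta>" by simp
    have ab: "\<xi> x \<in> F X" "\<zeta> y \<in> F Y"
      using coalg xy by (auto simp: coalgebra_def)
    show "fuzzy_lift F \<Lambda> X Y ?r (\<xi> x, \<zeta> y) \<le> \<delta>"
    \<comment> \<open>Thresholds range over the unit interval only; for \<delta> above 1 the bound
      is trivial.\<close>
    proof (cases "\<delta> \<le> 1")
      case False
      with fuzzy_lift_in_unit[of "\<xi> x" F X "\<zeta> y" Y \<Lambda> ?r, OF ab] show ?thesis by auto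
    next
      case True
      then have \<delta>: "\<delta> \<in> {0..1}"
        using less threshold_dist_in_unit[of F \<Lambda> X \<xi> Y \<zeta> x y] by auto
      obtain R where R: "eps_simulation F \<Lambda> X \<xi> Y \<zeta> \<delta> R" "(x, y) \<in> R"
        using eps_similar_if_threshold_dist_less[OF mono less True] by (auto simp: eps_similar_def)
      \<comment> \<open>The same \<open>R\<close> witnesses similarity for all of its pairs, not
        just for \<open>(x, y)\<close>.\<close>
      have "R \<subseteq> sublevel X Y ?r \<delta>"
      proof (clarify)
        fix u v assume uv: "(u, v) \<in> R"
        then have "threshold_dist F \<Lambda> X \<xi> Y \<zeta> u v \<le> \<delta>"
          using R(1) \<delta> by (intro threshold_dist_le) (auto simp: eps_similar_def)
        with uv R(1) show "(u, v) \<in> sublevel X Y ?r \<delta>"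
          by (auto simp: sublevel_def eps_simulation_def)
      qed
      moreover have "sublevel X Y ?r \<delta> \<subseteq> X \<times> Y"
        by (auto simp: sublevel_def)
      moreover have "(\<xi> x, \<zeta> y) \<in> lift_rel F \<Lambda> X Y \<delta> R"
        using R by (auto simp: eps_simulation_def)
      ultimately have "(\<xi> x, \<zeta> y) \<in> lift_rel F \<Lambda> X Y \<delta> (sublevel X Y ?r \<delta>)"
        using lift_rel_mono[OF mono order_refl] by blast
      then show ?thesis using \<delta> by (rule fuzzy_lift_le)
    qed
  qed
qed

lemma eps_simulation_strict_sublevel:
  assumes mono: "\<forall>l\<in>\<Lambda>. monotone_lifting F l"
    and coalg: "coalgebra F X \<xi>" "coalgebra F Y \<zeta>"
    and sim: "fuzzy_simulation F \<Lambda> X \<xi> Y \<zeta> r" and "\<delta> \<le> 1"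
  shows "eps_simulation F \<Lambda> X \<xi> Y \<zeta> \<delta> {(x, y) \<in> X \<times> Y. r (x, y) < \<delta>}"
    (is "eps_simulation _ _ _ _ _ _ _ ?R")
  unfolding eps_simulation_def
proof (intro conjI)
  show "?R \<subseteq> X \<times> Y" by auto
  show "\<forall>(x, y)\<in>?R. (\<xi> x, \<zeta> y) \<in> lift_rel F \<Lambda> X Y \<delta> ?R"
  proof clarify
    fix x y assume xy: "x \<in> X" "y \<in> Y" and "r (x, y) < \<delta>"
    then have less: "fuzzy_lift F \<Lambda> X Y r (\<xi> x, \<zeta> y) < \<delta>"
      using sim by (force simp: fuzzy_simulation_def)
    have ab: "\<xi> x \<in> F X" "\<zeta> y \<in> F Y"
      using coalg xy by (auto simp: coalgebra_def)
    obtain \<epsilon> where \<epsilon>: "\<epsilon> < \<delta>" "(\<xi> x, \<zeta> y) \<in> lift_rel F \<Lambda> X Y \<epsilon> (sublevel X Y r \<epsilon>)"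
      using fuzzy_lift_lessE[of "\<xi> x" F X "\<zeta> y" Y, OF ab less \<open>\<delta> \<le> 1\<close>] .
    \<comment> \<open>The gap between \<epsilon> and \<delta> is what fits the non-strict sublevel
      at \<epsilon> into the strict one at \<delta>.\<close>
    have "sublevel X Y r \<epsilon> \<subseteq> ?R" "?R \<subseteq> X \<times> Y"
      using \<epsilon>(1) by (auto simp: sublevel_def)
    then show "(\<xi> x, \<zeta> y) \<in> lift_rel F \<Lambda> X Y \<delta> ?R"
      using lift_rel_mono[OF mono less_imp_le[OF \<epsilon>(1)]] \<epsilon>(2) by blast
  qed
qed

lemma threshold_dist_le_fuzzy_simulation:
  assumes mono: "\<forall>l\<in>\<Lambda>. monotone_lifting F l"
    and coalg: "coalgebra F X \<xi>" "coalgebra F Y \<zeta>"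
    and sim: "fuzzy_simulation F \<Lambda> X \<xi> Y \<zeta> r" and xy: "x \<in> X" "y \<in> Y"
  shows "threshold_dist F \<Lambda> X \<xi> Y \<zeta> x y \<le> r (x, y)"
\<comment> \<open>For \<delta> strictly above \<open>r (x, y)\<close>, the pair
  \<open>(x, y)\<close> belongs to the strict sublevel relation at \<delta>.\<close>
proof (rule dense_ge)
  fix \<delta> assume less: "r (x, y) < \<delta>"
  show "threshold_dist F \<Lambda> X \<xi> Y \<zeta> x y \<le> \<delta>"
  proof (cases "\<delta> \<le> 1")
    case False
    with threshold_dist_in_unit[of F \<Lambda> X \<xi> Y \<zeta> x y] show ?thesis by auto
  next
    case True
    \<comment> \<open>Nonnegativity of \<open>r (x, y)\<close> makes \<delta> nonnegative, hence an
      admissible threshold.\<close>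
    have "r (x, y) \<in> {0..1}"
      using sim xy by (auto simp: fuzzy_simulation_def)
    moreover have "eps_similar F \<Lambda> X \<xi> Y \<zeta> \<delta> x y"
      unfolding eps_similar_def
      using eps_simulation_strict_sublevel[OF mono coalg sim True] xy less by blast
    ultimately show ?thesis
      using True less by (intro threshold_dist_le) auto
  qed
qed

theorem theorem3p9:
  fixes F :: "'u set \<Rightarrow> 'f set"
    and Fmap :: "'u set \<Rightarrow> 'u set \<Rightarrow> ('u \<Rightarrow> 'u) \<Rightarrow> 'f \<Rightarrow> 'f"
    and \<Lambda> :: "('u, 'f) lifting set"
    and X Y :: "'u set" and \<xi> \<zeta> :: "'u \<Rightarrow> 'f" and x y :: 'u
  assumes "set_functor F Fmap"
    and "\<forall>l\<in>\<Lambda>. predicate_lifting F Fmap l \<and> monotone_lifting F l"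
    and "coalgebra F X \<xi>" and "coalgebra F Y \<zeta>"
    and "x \<in> X" and "y \<in> Y"
  shows "threshold_dist F \<Lambda> X \<xi> Y \<zeta> x y = fuzzy_dist F \<Lambda> X \<xi> Y \<zeta> (x, y)"
proof -
  let ?r = "\<lambda>(x, y)\<in>X \<times> Y. threshold_dist F \<Lambda> X \<xi> Y \<zeta> x y"
  have mono: "\<forall>l\<in>\<Lambda>. monotone_lifting F l"
    using assms(2) by blast
  have "fuzzy_dist F \<Lambda> X \<xi> Y \<zeta> = ?r"
    unfolding fuzzy_dist_def
  \<comment> \<open>The least simulation is exhibited explicitly, so its existence is established
    along the way without a fixed-point theorem.\<close>
  proof (rule Least_equality)
    show "fuzzy_simulation F \<Lambda> X \<xi> Y \<zeta> ?r"
      using fuzzy_simulation_threshold_dist[OF mono assms(3,4)] .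
  next
    fix r assume sim: "fuzzy_simulation F \<Lambda> X \<xi> Y \<zeta> r"
    show "?r \<le> r"
    proof (rule le_funI)
      fix p
      show "?r p \<le> r p"
      proof (cases "p \<in> X \<times> Y")
        case True
        then show ?thesis
          using threshold_dist_le_fuzzy_simulation[OF mono assms(3,4) sim] by auto
      next
        \<comment> \<open>The order compares functions on the whole type; off
          \<open>X \<times> Y\<close> both sides are \<open>undefined\<close> by
          extensionality.\<close>
        case False
        have "r \<in> X \<times> Y \<rightarrow>\<^sub>E {0..1}"
          using sim by (simp add: fuzzy_simulation_def)
        then have "r p = undefined"
          using False by (rule PiE_arb)
        moreover have "?r p = undefined"
          using False by (rule restrict_apply[THEN trans, OF if_not_P])
        ultimately show ?thesis by linarith
      qed
    qed
  qed
  then show ?thesis using assms(5,6) by simp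
qed

end
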